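(* Let $N>n\ge 3$. A pair $(S,w)$ is valid in $K_N$ with all edge weights at most one if and only if there exists an assignment to variables $y=(y_{W,I})$ such that $\{S,w,y\}$ is a feasible solution to the following system $\mathrm{ILP}_{N,n}$: for all $\varnothing\ne I\subseteq[n]$ and all cuts $W\subseteq[N-1]$ in $K_N$ such that $I=W\cap[n]$, $$S_I\le\|C(W)\|,$$ $$\|C(W)\|\le S_I+|W|\,(N-|W|)\,y_{W,I},$$ $$\sum_{W\cap[n]=I}y_{W,I}=2^{N-|I|-1}-1,$$ $$y_{W,I}\in\{0,1\},$$ $$0\le w(e)\le 1\quad\text{for all } e\in E_N.$$
   Context: For a positive integer $k$ let $[k]=\{1,\dots,k\}$. $K_N$ is the undirected complete graph on vertex set $[N]$, with edge set $E_N=\{(i,j):1\le i<j\le N\}$. For edge weights $w=(w(e))_{e\in E_N}$ and $W\subseteq[N]$, the cut $C(W)$ is the set of edges with exactly one endpoint in $W$, and $\|C(W)\|=\sum_{e\in C(W)}w(e)$ is its total weight. The vertices in $[n]$ are terminals and vertex $N$ is the sink. The pair $(S,w)$ with $S=(S_I)_{\varnothing\ne I\subseteq[n]}$ is a valid pair in $K_N$ (that is, $w$ realizes $S$ in $K_N$) if $w\ge 0$ and $S_I=\min\{\|C(W)\| : W\subseteq[N-1],\ W\cap[n]=I\}$ for every $\varnothing\ne I\subseteq[n]$. For each $\varnothing\ne I\subseteq[n]$, the number of cuts $W\subseteq[N-1]$ in $K_N$ that contain $I$ is $2^{N-|I|-1}$; for each such $W$ and $I$ a binary variable $y_{W,I}$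 is introduced.
   Formalization: The right-hand side 2^{N-|I|-1}-1 of the sum constraint is replaced by 2^{N-n-1}-1 (number of W with W∩[n]=I, minus one); as printed, for |I|=1 the sum cannot reach that value, so the system is infeasible although w=0, S=0 is valid. *)

theory Defs
  imports Complex_Main
begin

definition edges :: "nat \<Rightarrow> (nat \<times> nat) set" where
  "edges N = {(i, j). 1 \<le> i \<and> i < j \<and> j \<le> N}"

definition cut :: "nat \<Rightarrow> nat set \<Rightarrow> (nat \<times> nat) set" where
  "cut N W = {(i, j) \<in> edges N. (i \<in> W) \<noteq> (j \<in> W)}"

definition cut_weight :: "nat \<Rightarrow> (nat \<times> nat \<Rightarrow> real) \<Rightarrow> nat set \<Rightarrow> real" where
  "cut_weight N w W = (\<Sum>e\<in>cut N W. w e)"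

definition terminal_sets :: "nat \<Rightarrow> nat set set" where
  "terminal_sets n = {I. I \<noteq> {} \<and> I \<subseteq> {1..n}}"

text \<open>The vertex sets that contain exactly the terminals in \<open>I\<close> and avoid the sink \<open>N\<close>.\<close>

definition cut_sets :: "nat \<Rightarrow> nat \<Rightarrow> nat set \<Rightarrow> nat set set" where
  "cut_sets N n I = {W. W \<subseteq> {1..N - 1} \<and> W \<inter> {1..n} = I}"

text \<open>
  The families \<open>S\<close>, \<open>w\<close> and \<open>y\<close> are total functions; only the values of \<open>S\<close> on
  \<^term>\<open>terminal_sets n\<close>, of \<open>w\<close> on \<^term>\<open>edges N\<close>, and of \<open>y W I\<close> for
  \<open>I \<in> terminal_sets n\<close> and \<open>W \<in> cut_sets N n I\<close> matter below.
\<close>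

definition valid_pair ::
    "nat \<Rightarrow> nat \<Rightarrow> (nat set \<Rightarrow> real) \<Rightarrow> (nat \<times> nat \<Rightarrow> real) \<Rightarrow> bool" where
  "valid_pair N n S w \<longleftrightarrow>
     (\<forall>e\<in>edges N. 0 \<le> w e) \<and>
     (\<forall>I\<in>terminal_sets n. S I = Min (cut_weight N w ` cut_sets N n I))"

lemma card_cut_sets:
  assumes "n < N" "I \<subseteq> {1..n}"
  shows "card (cut_sets N n I) = 2 ^ (N - n - 1)"
proof -
  have "bij_betw (\<lambda>U. I \<union> U) (Pow {n + 1..N - 1}) (cut_sets N n I)"
  proof (rule bij_betw_byWitness[where f' = "\<lambda>W. W - {1..n}"])
    show "\<forall>U\<in>Pow {n + 1..N - 1}. I \<union> U - {1..n} = U"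
      using assms by fastforce
    show "\<forall>W\<in>cut_sets N n I. I \<union> (W - {1..n}) = W"
      by (auto simp: cut_sets_def)
    show "(\<lambda>U. I \<union> U) ` Pow {n + 1..N - 1} \<subseteq> cut_sets N n I"
      using assms by (fastforce simp: cut_sets_def)
    show "(\<lambda>W. W - {1..n}) ` cut_sets N n I \<subseteq> Pow {n + 1..N - 1}"
      by (force simp: cut_sets_def)
  qed
  then have "card (cut_sets N n I) = card (Pow {n + 1..N - 1})"
    by (simp add: bij_betw_same_card)
  then show ?thesis by (simp add: card_Pow)
qed

text \<open>
  The cardinality constraint says that \<open>y W I = 0\<close> for exactly one \<open>W\<close> with
  \<open>W \<inter> {1..n} = I\<close>. The sum has \<open>2 ^ (N - n - 1)\<close> summands (see \<open>card_cut_sets\<close>), so the right-hand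
  side is \<open>2 ^ (N - n - 1) - 1\<close>. The number \<open>2 ^ (N - card I - 1)\<close>, with which this
  constraint is stated in the source, instead counts the \<open>W\<close> with \<open>I \<subseteq> W\<close>; with
  that right-hand side the system would have no solution at all, see
  \<open>superset_count_infeasible\<close> below.
\<close>

definition ilp_feasible ::
    "nat \<Rightarrow> nat \<Rightarrow> (nat set \<Rightarrow> real) \<Rightarrow> (nat \<times> nat \<Rightarrow> real) \<Rightarrow> (nat set \<Rightarrow> nat set \<Rightarrow> real) \<Rightarrow> bool"
  where
  "ilp_feasible N n S w y \<longleftrightarrow>
     (\<forall>I\<in>terminal_sets n. \<forall>W\<in>cut_sets N n I.
        S I \<le> cut_weight N w W \<and>
        cut_weight N w W \<le> S I + real (card W) * (real N - real (card W)) * y W I \<and>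
        y W I \<in> {0, 1}) \<and>
     (\<forall>I\<in>terminal_sets n. (\<Sum>W\<in>cut_sets N n I. y W I) = 2 ^ (N - n - 1) - 1) \<and>
     (\<forall>e\<in>edges N. 0 \<le> w e \<and> w e \<le> 1)"

lemma superset_count_infeasible:
  fixes y :: "nat set \<Rightarrow> nat set \<Rightarrow> real"
  assumes "3 \<le> n" "n < N"
    and "\<forall>I\<in>terminal_sets n. \<forall>W\<in>cut_sets N n I. y W I \<in> {0, 1}"
  shows "\<not> (\<forall>I\<in>terminal_sets n. (\<Sum>W\<in>cut_sets N n I. y W I) = 2 ^ (N - card I - 1) - 1)"
proof
  assume *: "\<forall>I\<in>terminal_sets n. (\<Sum>W\<in>cut_sets N n I. y W I) = 2 ^ (N - card I - 1) - 1"
  have I: "{1} \<in> terminal_sets n" using assms(1) by (auto simp: terminal_sets_def)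
  have "(\<Sum>W\<in>cut_sets N n {1}. y W {1}) \<le> (\<Sum>W\<in>cut_sets N n {1}. 1)"
    using assms(3) I by (intro sum_mono) fastforce
  also have "\<dots> = 2 ^ (N - n - 1)"
    using card_cut_sets[of n N "{1}"] assms(1,2) by simp
  finally have le: "(2::real) ^ (N - 2) - 1 \<le> 2 ^ (N - n - 1)"
    using * I by (auto simp: numeral_2_eq_2)
  have "(2::real) ^ (N - n - 1 + 2) \<le> 2 ^ (N - 2)"
    using assms(1,2) by (intro power_increasing) auto
  then have "4 * (2::real) ^ (N - n - 1) \<le> 2 ^ (N - 2)"
    by (simp add: power_add)
  moreover have "(1::real) \<le> 2 ^ (N - n - 1)" by simp
  ultimately show False using le by linarith
qed

end

theory Submission
  imports Defs
begin

text \<open>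
  A binary \<open>y W I\<close> equal to 1 makes the upper bound on \<open>cut_weight N w W\<close> vacuous, because weights
  at most 1 give \<open>cut_weight N w W \<le> card W * (N - card W)\<close>; a value 0 forces
  \<open>cut_weight N w W = S I\<close>. The cardinality constraint leaves exactly one 0 for each \<open>I\<close>, and this
  zero marks a minimum cut.
\<close>

lemma finite_edges: "finite (edges N)"
  by (rule finite_subset[of _ "{1..N} \<times> {1..N}"]) (auto simp: edges_def)

lemma finite_cut: "finite (cut N W)"
  by (rule finite_subset[OF _ finite_edges]) (auto simp: cut_def)

lemma finite_cut_sets: "finite (cut_sets N n I)"
  by (rule finite_subset[of _ "Pow {1..N - 1}"]) (auto simp: cut_sets_def)

text \<open>Orienting every cut edge from its endpoint in \<open>W\<close> to its endpoint outside
  embeds the cut into \<open>W \<times> ({1..N} - W)\<close>.\<close>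

lemma card_cut_le:
  assumes "W \<subseteq> {1..N}"
  shows "card (cut N W) \<le> card W * (N - card W)"
proof -
  have "card (cut N W) \<le> card (W \<times> ({1..N} - W))"
  proof (rule card_inj_on_le)
    \<comment> \<open>A collision between a kept and a swapped pair would need both
      \<open>(i, j)\<close> and \<open>(j, i)\<close> to be edges, which \<open>i < j\<close>
      excludes.\<close>
    show "inj_on (\<lambda>(i, j). if i \<in> W then (i, j) else (j, i)) (cut N W)"
      by (auto simp: inj_on_def cut_def edges_def split: if_splits)
    show "(\<lambda>(i, j). if i \<in> W then (i, j) else (j, i)) ` cut N W \<subseteq> W \<times> ({1..N} - W)"
      by (auto simp: cut_def edges_def)
    show "finite (W \<times> ({1..N} - W))"
      using assms by (auto intro: finite_subset)
  qed
  also have "\<dots> = card W * (N - card W)"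
    using assms by (simp add: card_cartesian_product card_Diff_subset finite_subset)
  finally show ?thesis .
qed

lemma cut_weight_nonneg:
  assumes "\<forall>e\<in>edges N. 0 \<le> w e"
  shows "0 \<le> cut_weight N w W"
  unfolding cut_weight_def using assms by (intro sum_nonneg) (auto simp: cut_def)

lemma cut_weight_le:
  assumes "W \<subseteq> {1..N}" "\<forall>e\<in>edges N. w e \<le> 1"
  shows "cut_weight N w W \<le> real (card W) * (real N - real (card W))"
proof -
  have "cut_weight N w W \<le> (\<Sum>e\<in>cut N W. 1)"
    unfolding cut_weight_def using assms(2) by (intro sum_mono) (auto simp: cut_def)
  also have "\<dots> \<le> real (card W * (N - card W))"
    using card_cut_le[OF assms(1)] by (simp flip: of_nat_mult)
  \<comment> \<open>Truncated subtraction agrees with real subtraction here because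
    \<open>card W \<le> N\<close>.\<close>
  also have "\<dots> = real (card W) * (real N - real (card W))"
    using card_mono[OF _ assms(1)] by (simp add: of_nat_diff)
  finally show ?thesis .
qed

lemma ilp_feasible_if_valid_pair:
  assumes "n < N" "valid_pair N n S w" "\<forall>e\<in>edges N. w e \<le> 1"
  shows "\<exists>y. ilp_feasible N n S w y"
proof -
  have w0: "\<forall>e\<in>edges N. 0 \<le> w e" using assms(2) by (simp add: valid_pair_def)
  have S: "S I = Min (cut_weight N w ` cut_sets N n I)" if "I \<in> terminal_sets n" for I
    using assms(2) that by (simp add: valid_pair_def)
  have card: "card (cut_sets N n I) = 2 ^ (N - n - 1)" if "I \<in> terminal_sets n" for I
    using that assms(1) by (intro card_cut_sets) (auto simp: terminal_sets_def)
  have "\<exists>W\<in>cut_sets N n I. S I = cut_weight N w W" if I: "I \<in> terminal_sets n" for I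
  proof -
    \<comment> \<open>A power of two is never 0, so there is a cut to minimise over and the minimum
      is attained.\<close>
    have "cut_sets N n I \<noteq> {}" using card[OF I] by fastforce
    then have "S I \<in> cut_weight N w ` cut_sets N n I"
      unfolding S[OF I] by (intro Min_in) (auto simp: finite_cut_sets)
    then show ?thesis by blast
  qed
  then obtain M where M: "\<And>I. I \<in> terminal_sets n \<Longrightarrow> M I \<in> cut_sets N n I \<and> S I = cut_weight N w (M I)"
    by metis
  \<comment> \<open>Several cuts may attain the minimum; only the chosen \<open>M I\<close> gets the
    value 0, so that the sum falls short of the number of cuts by exactly one.\<close>
  define y :: "nat set \<Rightarrow> nat set \<Rightarrow> real" where "y = (\<lambda>W I. if W = M I then 0 else 1)"
  have "S I \<le> cut_weight N w W \<and>
        cut_weight N w W \<le> S I + real (card W) * (real N - real (card W)) * y W I \<and>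
        y W I \<in> {0, 1}"
    if I: "I \<in> terminal_sets n" and W: "W \<in> cut_sets N n I" for I W
  proof -
    have "S I \<le> cut_weight N w W"
      unfolding S[OF I] using W by (intro Min_le) (auto simp: finite_cut_sets)
    \<comment> \<open>For \<open>W \<noteq> M I\<close> the bound \<open>cut_weight_le\<close> lacks
      the summand \<open>S I\<close>; adding it keeps the bound valid because it is
      nonnegative.\<close>
    moreover have "0 \<le> S I" using M[OF I] cut_weight_nonneg[OF w0] by metis
    moreover have "W \<subseteq> {1..N}" using W by (fastforce simp: cut_sets_def)
    ultimately show ?thesis
      using M[OF I] cut_weight_le[OF _ assms(3), of W] by (auto simp: y_def)
  qed
  moreover have "(\<Sum>W\<in>cut_sets N n I. y W I) = 2 ^ (N - n - 1) - 1"
    if I: "I \<in> terminal_sets n" for I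
  proof -
    have "(\<Sum>W\<in>cut_sets N n I. y W I) = (\<Sum>W\<in>cut_sets N n I - {M I}. 1)"
      using M[OF I] by (subst sum.remove[of _ "M I"]) (auto simp: finite_cut_sets y_def)
    also have "\<dots> = 2 ^ (N - n - 1) - 1"
      using M[OF I] card[OF I] by (simp add: card_Diff_singleton of_nat_diff)
    finally show ?thesis .
  qed
  ultimately have "ilp_feasible N n S w y"
    using w0 assms(3) by (simp add: ilp_feasible_def)
  then show ?thesis by blast
qed

lemma valid_pair_if_ilp_feasible:
  assumes "n < N" "ilp_feasible N n S w y"
  shows "valid_pair N n S w"
proof -
  have "S I = Min (cut_weight N w ` cut_sets N n I)" if I: "I \<in> terminal_sets n" for I
  proof -
    have y: "S I \<le> cut_weight N w W"
        "cut_weight N w W \<le> S I + real (card W) * (real N - real (card W)) * y W I"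
        "y W I = 0 \<or> y W I = 1"
      if "W \<in> cut_sets N n I" for W
      using assms(2) I that by (auto simp: ilp_feasible_def)
    \<comment> \<open>If all values were 1, the sum would be the full number of cuts, one more than
      the constraint allows.\<close>
    have "\<exists>W\<in>cut_sets N n I. y W I = 0"
    proof (rule ccontr)
      assume "\<not> ?thesis"
      then have "(\<Sum>W\<in>cut_sets N n I. y W I) = (\<Sum>W\<in>cut_sets N n I. 1)"
        using y(3) by (intro sum.cong) auto
      also have "\<dots> = 2 ^ (N - n - 1)"
        using card_cut_sets[OF assms(1), of I] I by (simp add: terminal_sets_def)
      finally show False using assms(2) I by (simp add: ilp_feasible_def)
    qed
    then obtain W where W: "W \<in> cut_sets N n I" "y W I = 0" by blast
    \<comment> \<open>With \<open>y W I = 0\<close> the product term vanishes and the two bounds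
      pinch. Since \<open>S I\<close> is also a lower bound for every other cut, it is the
      minimum.\<close>
    then have "S I = cut_weight N w W" using y(1,2)[OF W(1)] by simp
    then show ?thesis
      using W(1) y(1) by (intro Min_eqI[symmetric]) (auto simp: finite_cut_sets)
  qed
  then show ?thesis using assms(2) by (simp add: valid_pair_def ilp_feasible_def)
qed

theorem proposition9:
  fixes N n :: nat
    and S :: "nat set \<Rightarrow> real"
    and w :: "nat \<times> nat \<Rightarrow> real"
  assumes "3 \<le> n" and "n < N"
  shows "(valid_pair N n S w \<and> (\<forall>e\<in>edges N. w e \<le> 1)) \<longleftrightarrow>
         (\<exists>y :: nat set \<Rightarrow> nat set \<Rightarrow> real. ilp_feasible N n S w y)"
proof -
  have "\<forall>e\<in>edges N. w e \<le> 1" if "ilp_feasible N n S w y" for y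
    using that by (simp add: ilp_feasible_def)
  then show ?thesis
    using ilp_feasible_if_valid_pair[OF assms(2)] valid_pair_if_ilp_feasible[OF assms(2)] by blast
qed

end
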